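(* Let $(A,\cdot,\circ)$ be a transposed Novikov-Poisson algebra over $\mathbf{k}$. Then the following identities hold for all $x,y,z,h\in A$: $$(x\circ y)\cdot z=(x\circ z)\cdot y,$$ $$(x\circ y)\circ(h\cdot z)=(x\circ z)\circ(h\cdot y),$$ $$(x\circ y)\circ(h\cdot z)-(y\circ x)\circ(h\cdot z)=(h\cdot x)\circ(y\circ z)-(h\cdot y)\circ(x\circ z).$$ Moreover, if the characteristic of $\mathbf{k}$ is not equal to $3$, then also $$(x\circ y)\circ(h\cdot z)=(y\circ x)\circ(h\cdot z)$$ for all $x,y,z,h\in A$.
   Context: $\mathbf{k}$ is a field of characteristic not equal to $2$; all binary operations are $\mathbf{k}$-bilinear and algebras need not be unital. A (left) Novikov algebra $(A,\circ)$ is a vector space with a binary operation satisfying $(x\circ y)\circ z=(x\circ z)\circ y$ and $(x\circ y)\circ z-x\circ(y\circ z)=(y\circ x)\circ z-y\circ(x\circ z)$ for all $x,y,z$. A transposed Novikov-Poisson algebra is a triple $(A,\cdot,\circ)$ where $(A,\cdot)$ is a commutative associative algebra, $(A,\circ)$ is a Novikov algebra, and for all $x,y,z\in A$: $(x\cdot y)\circ z=(x\cdot z)\circ y$ and $2z\cdot(x\circ y)=(z\cdot x)\circ y+x\circ(z\cdot y)$. *)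

theory Defs
  imports "HOL-Computational_Algebra.Computational_Algebra"
begin

text \<open>
  An algebra over a field is a vector space with a bilinear operation; no unit is assumed.
  The underlying space is a whole type \<open>'a\<close>, of arbitrary dimension.
\<close>

locale bilinear_operation = vector_space scale
  for scale :: "'k::field \<Rightarrow> 'a::ab_group_add \<Rightarrow> 'a" +
  fixes prod :: "'a \<Rightarrow> 'a \<Rightarrow> 'a"
  assumes linear_left: "Vector_Spaces.linear scale scale (\<lambda>x. prod x y)"
    and linear_right: "Vector_Spaces.linear scale scale (\<lambda>y. prod x y)"

locale comm_assoc_algebra = bilinear_operation scale mul
  for scale :: "'k::field \<Rightarrow> 'a::ab_group_add \<Rightarrow> 'a"
    and mul :: "'a \<Rightarrow> 'a \<Rightarrow> 'a" (infixl \<open>\<cdot>\<close> 70) +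
  assumes mul_commute: "x \<cdot> y = y \<cdot> x"
    and mul_assoc: "(x \<cdot> y) \<cdot> z = x \<cdot> (y \<cdot> z)"

locale novikov_algebra = bilinear_operation scale nov
  for scale :: "'k::field \<Rightarrow> 'a::ab_group_add \<Rightarrow> 'a"
    and nov :: "'a \<Rightarrow> 'a \<Rightarrow> 'a" (infixl \<open>\<odot>\<close> 70) +
  assumes right_commutative: "(x \<odot> y) \<odot> z = (x \<odot> z) \<odot> y"
    and left_symmetric:
      "(x \<odot> y) \<odot> z - x \<odot> (y \<odot> z) = (y \<odot> x) \<odot> z - y \<odot> (x \<odot> z)"

locale transposed_novikov_poisson_algebra =
  comm_assoc_algebra scale mul + novikov_algebra scale nov
  for scale :: "'k::field \<Rightarrow> 'a::ab_group_add \<Rightarrow> 'a"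
    and mul :: "'a \<Rightarrow> 'a \<Rightarrow> 'a" (infixl \<open>\<cdot>\<close> 70)
    and nov :: "'a \<Rightarrow> 'a \<Rightarrow> 'a" (infixl \<open>\<odot>\<close> 70) +
  assumes mul_nov_swap: "(x \<cdot> y) \<odot> z = (x \<cdot> z) \<odot> y"
    and transposed_leibniz:
      "scale 2 (z \<cdot> (x \<odot> y)) = (z \<cdot> x) \<odot> y + x \<odot> (z \<cdot> y)"

end

theory Submission
  imports Defs
begin

text \<open>
  Two symmetries drive the proof. The product \<open>(x \<cdot> y) \<odot> z\<close> is totally symmetric in its three
  arguments, and the transposed Leibniz rule solves for \<open>x \<odot> (z \<cdot> y)\<close>, so a product on the
  right of \<open>\<odot>\<close> can always be traded for products outside or on the left of \<open>\<odot>\<close>.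

  The first two identities are immediate: the right-hand side of the Leibniz rule does not change
  when \<open>y\<close> and \<open>z\<close> are exchanged, so neither does \<open>(x \<odot> y) \<cdot> z\<close>, and applying the rule to
  \<open>(x \<odot> y) \<odot> (h \<cdot> z)\<close> leaves only terms symmetric in \<open>y\<close> and \<open>z\<close>.

  For the third, left symmetry says that the commutator \<open>c = x \<odot> y - y \<odot> x\<close> acts on the left as
  the commutator of the actions of \<open>x\<close> and \<open>y\<close>. Evaluating the action of \<open>c\<close> on \<open>h \<cdot> z\<close> by the
  Leibniz rule, once directly and once through the two successive actions, and comparing
  gives the identity (\<open>nov_commutator_mul\<close>).

  For the fourth, put \<open>F x y z h = (x \<odot> y) \<odot> (h \<cdot> z)\<close> and
  \<open>G x y z h = (h \<cdot> y) \<odot> (x \<odot> z)\<close>. Both are symmetric in the last three arguments, so the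
  only question is whether \<open>x\<close> may be exchanged with \<open>y\<close>. The third identity says that \<open>F + G\<close>
  allows this exchange, and expanding \<open>2G\<close> by the Leibniz rule shows that \<open>2G - F\<close> allows it
  too. Hence so does \<open>3F = 2(F + G) - (2G - F)\<close>.
\<close>

context vector_space
begin

lemma scale_2: "scale 2 u = u + u"
  by (metis one_add_one scale_left_distrib scale_one)

lemma scale_prime_cancel:
  assumes p: "prime p" and char: "CHAR('a) \<noteq> p"
    and eq: "scale (of_nat p) u = scale (of_nat p) v"
  shows "u = v"
proof -
  have "\<not> CHAR('a) dvd p"
    using p char CHAR_not_1 by (metis One_nat_def prime_nat_iff)
  then have "(of_nat p :: 'a) \<noteq> 0"
    by (simp add: of_nat_eq_0_iff_char_dvd)
  with eq show ?thesis
    by simp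
qed

end

context bilinear_operation
begin

lemma prod_add_left: "prod (x + y) z = prod x z + prod y z"
  using linear_left by (simp add: Vector_Spaces.linear_iff)

lemma prod_add_right: "prod z (x + y) = prod z x + prod z y"
  using linear_right by (simp add: Vector_Spaces.linear_iff)

lemma prod_diff_left: "prod (x - y) z = prod x z - prod y z"
  by (metis add_diff_cancel diff_add_cancel prod_add_left)

lemma prod_diff_right: "prod z (x - y) = prod z x - prod z y"
  by (metis add_diff_cancel diff_add_cancel prod_add_right)

end

lemmas (in comm_assoc_algebra) mul_diff_right = prod_diff_right

lemmas (in novikov_algebra) nov_add_left = prod_add_left
  and nov_add_right = prod_add_right
  and nov_diff_left = prod_diff_left
  and nov_diff_right = prod_diff_right

text \<open>Left symmetry makes left multiplication a representation of the commutator bracket.\<close>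

lemma (in novikov_algebra) nov_commutator:
  "(x \<odot> y - y \<odot> x) \<odot> z = x \<odot> (y \<odot> z) - y \<odot> (x \<odot> z)"
  using left_symmetric[of x y z] by (simp add: prod_diff_left algebra_simps)

locale transposed_novikov_poisson_algebra_char_not_2 =
  transposed_novikov_poisson_algebra scale mul nov
  for scale :: "'k::field \<Rightarrow> 'a::ab_group_add \<Rightarrow> 'a"
    and mul :: "'a \<Rightarrow> 'a \<Rightarrow> 'a" (infixl \<open>\<cdot>\<close> 70)
    and nov :: "'a \<Rightarrow> 'a \<Rightarrow> 'a" (infixl \<open>\<odot>\<close> 70) +
  assumes char_not_2: "CHAR('k) \<noteq> 2"
begin

lemma double_cancel: "u + u = v + v \<Longrightarrow> u = v" for u v :: 'a
  using scale_prime_cancel[of 2 u v] char_not_2 by (simp add: scale_2)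

lemma leibniz: "z \<cdot> (x \<odot> y) + z \<cdot> (x \<odot> y) = (z \<cdot> x) \<odot> y + x \<odot> (z \<cdot> y)"
  using transposed_leibniz by (simp add: scale_2)

lemma nov_mul_right: "x \<odot> (z \<cdot> y) = z \<cdot> (x \<odot> y) + z \<cdot> (x \<odot> y) - (z \<cdot> x) \<odot> y"
  by (simp add: leibniz)

lemma mul_nov_rotate: "(x \<cdot> y) \<odot> z = (y \<cdot> z) \<odot> x"
  by (metis mul_commute mul_nov_swap)

text \<open>
  Both terms on the right of the Leibniz rule are symmetric in \<open>y\<close> and \<open>z\<close>, and \<open>2\<close> is
  invertible.
\<close>

lemma nov_mul_swap: "(x \<odot> y) \<cdot> z = (x \<odot> z) \<cdot> y"
proof (rule double_cancel)
  have "(z \<cdot> x) \<odot> y = (y \<cdot> x) \<odot> z"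
    by (metis mul_commute mul_nov_swap)
  then have "z \<cdot> (x \<odot> y) + z \<cdot> (x \<odot> y) = y \<cdot> (x \<odot> z) + y \<cdot> (x \<odot> z)"
    unfolding leibniz by (simp only: mul_commute[of y z])
  then show "(x \<odot> y) \<cdot> z + (x \<odot> y) \<cdot> z = (x \<odot> z) \<cdot> y + (x \<odot> z) \<cdot> y"
    by (simp only: mul_commute)
qed

lemma mul_nov_nov_swap: "(h \<cdot> (x \<odot> y)) \<odot> z = (h \<cdot> (x \<odot> z)) \<odot> y"
  by (metis mul_nov_rotate nov_mul_swap)

text \<open>
  The Leibniz rule expresses \<open>(x \<odot> y) \<odot> (h \<cdot> z)\<close> by \<open>h \<cdot> ((x \<odot> y) \<odot> z)\<close> and
  \<open>(h \<cdot> (x \<odot> y)) \<odot> z\<close>, and \<open>y\<close> and \<open>z\<close> can be exchanged in each of them.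
\<close>

lemma nov_nov_mul_swap: "(x \<odot> y) \<odot> (h \<cdot> z) = (x \<odot> z) \<odot> (h \<cdot> y)"
  by (simp only: nov_mul_right mul_nov_nov_swap[of h x y z] right_commutative[of x y z])

text \<open>
  With \<open>c\<close> the commutator and \<open>D\<close> the right-hand side, \<open>c \<odot> (h \<cdot> z)\<close> is the commutator of two
  successive actions on \<open>h \<cdot> z\<close>. Moving \<open>h\<close> outwards through both of them returns
  \<open>2 (c \<odot> (h \<cdot> z)) - D\<close>, so \<open>c \<odot> (h \<cdot> z) = D\<close>.
\<close>

lemma nov_commutator_mul:
  "(x \<odot> y) \<odot> (h \<cdot> z) - (y \<odot> x) \<odot> (h \<cdot> z)
    = (h \<cdot> x) \<odot> (y \<odot> z) - (h \<cdot> y) \<odot> (x \<odot> z)"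
proof -
  define c where "c = x \<odot> y - y \<odot> x"
  define D where "D = (h \<cdot> x) \<odot> (y \<odot> z) - (h \<cdot> y) \<odot> (x \<odot> z)"
  have expand: "a \<odot> (b \<odot> (h \<cdot> z)) =
      h \<cdot> (a \<odot> (b \<odot> z)) + h \<cdot> (a \<odot> (b \<odot> z)) + (h \<cdot> (a \<odot> (b \<odot> z)) + h \<cdot> (a \<odot> (b \<odot> z)))
      - (h \<cdot> a) \<odot> (b \<odot> z) - (h \<cdot> a) \<odot> (b \<odot> z) - a \<odot> ((h \<cdot> b) \<odot> z)" for a b
    by (simp add: nov_mul_right[of b] nov_mul_right[of a] nov_add_right nov_diff_right
        algebra_simps)
  have hc: "h \<cdot> (c \<odot> z) = h \<cdot> (x \<odot> (y \<odot> z)) - h \<cdot> (y \<odot> (x \<odot> z))"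
    by (simp add: c_def nov_commutator mul_diff_right)
  have c2: "x \<odot> (h \<cdot> y) - y \<odot> (h \<cdot> x) = h \<cdot> c + h \<cdot> c"
    by (simp add: nov_mul_right c_def mul_diff_right mul_nov_swap[of h x y] algebra_simps)
  \<comment> \<open>Left symmetry makes the outer action fall on \<open>h \<cdot> y\<close>; the terms \<open>((h \<cdot> y) \<odot> x) \<odot> z\<close> then
    cancel on antisymmetrizing in \<open>x\<close> and \<open>y\<close>.\<close>
  have nested: "x \<odot> ((h \<cdot> y) \<odot> z) =
      (x \<odot> (h \<cdot> y)) \<odot> z - ((h \<cdot> y) \<odot> x) \<odot> z + (h \<cdot> y) \<odot> (x \<odot> z)" for x y
    using left_symmetric[of x "h \<cdot> y" z] by (simp add: algebra_simps)
  have "x \<odot> ((h \<cdot> y) \<odot> z) - y \<odot> ((h \<cdot> x) \<odot> z)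
      = (x \<odot> (h \<cdot> y) - y \<odot> (h \<cdot> x)) \<odot> z - D"
    unfolding nested D_def by (simp add: nov_diff_left mul_nov_swap[of h x y] algebra_simps)
  then have inner: "x \<odot> ((h \<cdot> y) \<odot> z) - y \<odot> ((h \<cdot> x) \<odot> z)
      = (h \<cdot> c) \<odot> z + (h \<cdot> c) \<odot> z - D"
    by (simp add: c2 nov_add_left)
  have "c \<odot> (h \<cdot> z) = x \<odot> (y \<odot> (h \<cdot> z)) - y \<odot> (x \<odot> (h \<cdot> z))"
    by (simp add: c_def nov_commutator)
  also have "\<dots> = h \<cdot> (c \<odot> z) + h \<cdot> (c \<odot> z) + (h \<cdot> (c \<odot> z) + h \<cdot> (c \<odot> z)) - D - D
      - (x \<odot> ((h \<cdot> y) \<odot> z) - y \<odot> ((h \<cdot> x) \<odot> z))"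
    unfolding expand hc D_def by (simp add: algebra_simps)
  also have "\<dots> = c \<odot> (h \<cdot> z) + c \<odot> (h \<cdot> z) - D"
    unfolding inner nov_mul_right by (simp add: algebra_simps)
  finally have "c \<odot> (h \<cdot> z) = D"
    by (simp add: algebra_simps)
  then show ?thesis
    by (simp add: c_def D_def nov_diff_left)
qed

text \<open>
  Let \<open>F = (x \<odot> y) \<odot> (h \<cdot> z)\<close> and \<open>G = (h \<cdot> y) \<odot> (x \<odot> z)\<close>. Writing \<open>G\<close> as
  \<open>(y \<cdot> (x \<odot> z)) \<odot> h\<close> and applying the Leibniz rule inside shows that \<open>2G - F\<close> is
  \<open>((x \<cdot> y) \<odot> z) \<odot> h\<close>, in which \<open>x\<close> and \<open>y\<close> can be exchanged.
\<close>

lemma double_mul_nov_nov: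
  "(h \<cdot> y) \<odot> (x \<odot> z) + (h \<cdot> y) \<odot> (x \<odot> z)
    = ((x \<cdot> y) \<odot> z) \<odot> h + (x \<odot> y) \<odot> (h \<cdot> z)"
proof -
  have "(h \<cdot> y) \<odot> (x \<odot> z) + (h \<cdot> y) \<odot> (x \<odot> z) = (y \<cdot> (x \<odot> z) + y \<cdot> (x \<odot> z)) \<odot> h"
    by (simp add: nov_add_left mul_nov_rotate[of h y])
  also have "\<dots> = ((x \<cdot> y) \<odot> z) \<odot> h + (x \<odot> h) \<odot> (y \<cdot> z)"
    by (simp add: leibniz nov_add_left mul_commute[of y x] right_commutative[of x "y \<cdot> z" h])
  also have "(x \<odot> h) \<odot> (y \<cdot> z) = (x \<odot> y) \<odot> (h \<cdot> z)"
    by (metis mul_commute nov_nov_mul_swap)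
  finally show ?thesis .
qed

lemma nov_nov_mul_commute:
  assumes "CHAR('k) \<noteq> 3"
  shows "(x \<odot> y) \<odot> (h \<cdot> z) = (y \<odot> x) \<odot> (h \<cdot> z)"
proof -
  let ?F = "(x \<odot> y) \<odot> (h \<cdot> z)" and ?F' = "(y \<odot> x) \<odot> (h \<cdot> z)"
  let ?G = "(h \<cdot> y) \<odot> (x \<odot> z)" and ?G' = "(h \<cdot> x) \<odot> (y \<odot> z)"
  have sum: "?F + ?G = ?F' + ?G'"
    using nov_commutator_mul[of x y h z] by (simp add: algebra_simps)
  have "?G + ?G - ?F = ?G' + ?G' - ?F'"
    by (simp add: double_mul_nov_nov mul_commute[of y x])
  then have "?F + ?F + ?F = ?F' + ?F' + ?F'"
  proof -
    assume diff: "?G + ?G - ?F = ?G' + ?G' - ?F'"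
    have "?F + ?F + ?F = (?F + ?G) + (?F + ?G) - (?G + ?G - ?F)"
      by (simp add: algebra_simps)
    also have "\<dots> = (?F' + ?G') + (?F' + ?G') - (?G' + ?G' - ?F')"
      by (simp only: sum diff)
    also have "\<dots> = ?F' + ?F' + ?F'"
      by (simp add: algebra_simps)
    finally show ?thesis .
  qed
  moreover have "scale (of_nat 3) u = u + u + u" for u
  proof -
    have "(of_nat 3 :: 'k) = 2 + 1"
      by simp
    then show ?thesis
      by (simp only: scale_left_distrib scale_2 scale_one)
  qed
  ultimately show ?thesis
    using scale_prime_cancel[of 3 ?F ?F'] assms by simp
qed

end

theorem proposition2p20:
  fixes scale :: "'k::field \<Rightarrow> 'a::ab_group_add \<Rightarrow> 'a"
    and mul :: "'a \<Rightarrow> 'a \<Rightarrow> 'a" (infixl \<open>\<cdot>\<close> 70)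
    and nov :: "'a \<Rightarrow> 'a \<Rightarrow> 'a" (infixl \<open>\<odot>\<close> 70)
  assumes "CHAR('k) \<noteq> 2"
    and "transposed_novikov_poisson_algebra scale mul nov"
  shows "(\<forall>x y z. (x \<odot> y) \<cdot> z = (x \<odot> z) \<cdot> y) \<and>
    (\<forall>x y z h. (x \<odot> y) \<odot> (h \<cdot> z) = (x \<odot> z) \<odot> (h \<cdot> y)) \<and>
    (\<forall>x y z h. (x \<odot> y) \<odot> (h \<cdot> z) - (y \<odot> x) \<odot> (h \<cdot> z)
      = (h \<cdot> x) \<odot> (y \<odot> z) - (h \<cdot> y) \<odot> (x \<odot> z)) \<and>
    (CHAR('k) \<noteq> 3 \<longrightarrow>
      (\<forall>x y z h. (x \<odot> y) \<odot> (h \<cdot> z) = (y \<odot> x) \<odot> (h \<cdot> z)))"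
proof -
  interpret transposed_novikov_poisson_algebra_char_not_2 scale mul nov
    using assms by (intro transposed_novikov_poisson_algebra_char_not_2.intro
        transposed_novikov_poisson_algebra_char_not_2_axioms.intro)
  show ?thesis
    using nov_mul_swap nov_nov_mul_swap nov_commutator_mul nov_nov_mul_commute by blast
qed

end
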